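(* Let $X$ be a real normed space and let $\mathcal K\subset X$ be a co-radiant set. Then $\mathcal K$ admits a norm-base if and only if $\rho_{\mathcal K}$ is bounded above on $\operatorname{dom}(\rho_{\mathcal K})$. In this case, $\mathcal K$ is regular.
   Context: $X$ is a real normed space, $S_X$ its unit sphere, $B_X^\circ$ its open unit ball, $\operatorname{bd}$ denotes boundary. $\operatorname{cone}(A):=\{\lambda a:\lambda\ge 0,\ a\in A\}$. A cone is a nonempty $C\subset X$ with $\alpha C\subset C$ for all $\alpha\ge 0$. Co-radiant set: $\mathcal K\subset X$ with $\lambda x\in\mathcal K$ for all $x\in\mathcal K$, $\lambda\ge 1$; co-radiant sets are assumed nonempty with $0_X\notin\mathcal K$. Norm-base: for $t>0$, $\mathcal K\cap tS_X$ is a norm-base of $\mathcal K$ if for every $x\in\mathcal K$ there exist $y\in\mathcal K\cap tS_X$ and $\lambda>0$ with $x=\lambda y$; $\mathcal K$ admits a norm-base if this holds for some $t>0$. Interior reductions: for a cone $K$ and $\varepsilon>0$, $K^{-\varepsilon}:=K\setminus\bigl(\operatorname{cone}((\operatorname{bd}K\cap S_X)+\varepsilon B_X^\circ)\setminus\{0_X\}\bigr)$ (a cone, possibly trivial). For co-radiant $\mathcal K$, $\mathcal K^{-\varepsilon}:=\mathcal K\cap(\operatorname{cone}(\mathcal K))^{-\varepsilon}$. $\mathcal K$ is regular if, for every $\varepsilon>0$ with $\mathcal K^{-\varepsilon}\neq\varnothing$, the set $\mathcal K^{-\varepsilon}$ admits a norm-base. Radial profile: $\rho_{\mathcal K}:S_X\to[0,+\infty]$,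 $\rho_{\mathcal K}(v):=\inf\{\lambda>0:\lambda v\in\mathcal K\}$ with $\inf\varnothing=+\infty$; $\operatorname{dom}(\rho_{\mathcal K}):=\{v\in S_X:\rho_{\mathcal K}(v)<+\infty\}$. *)

theory Defs
  imports "HOL-Analysis.Analysis"
begin

definition co_radiant :: "'a::real_normed_vector set \<Rightarrow> bool" where
  "co_radiant K \<longleftrightarrow>
     K \<noteq> {} \<and> 0 \<notin> K \<and> (\<forall>x\<in>K. \<forall>c::real. c \<ge> 1 \<longrightarrow> c *\<^sub>R x \<in> K)"

text \<open>The library predicate \<open>cone\<close> says that a set is closed under nonnegative scaling;
  the following is the cone generated by a set (empty when the set is empty).\<close>

definition cone_of :: "'a::real_normed_vector set \<Rightarrow> 'a set" where
  "cone_of A = {c *\<^sub>R a | c a. c \<ge> 0 \<and> a \<in> A}"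

definition norm_base_at :: "'a::real_normed_vector set \<Rightarrow> real \<Rightarrow> bool" where
  "norm_base_at K t \<longleftrightarrow>
     t > 0 \<and> (\<forall>x\<in>K. \<exists>y \<in> K \<inter> sphere 0 t. \<exists>c::real. c > 0 \<and> x = c *\<^sub>R y)"

definition admits_norm_base :: "'a::real_normed_vector set \<Rightarrow> bool" where
  "admits_norm_base K \<longleftrightarrow> (\<exists>t. norm_base_at K t)"

definition cone_reduction :: "'a::real_normed_vector set \<Rightarrow> real \<Rightarrow> 'a set" where
  "cone_reduction C \<epsilon> =
     C - (cone_of {u + \<epsilon> *\<^sub>R b | u b. u \<in> frontier C \<inter> sphere 0 1 \<and> b \<in> ball 0 1} - {0})"

definition co_radiant_reduction :: "'a::real_normed_vector set \<Rightarrow> real \<Rightarrow> 'a set" where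
  "co_radiant_reduction K \<epsilon> = K \<inter> cone_reduction (cone_of K) \<epsilon>"

definition regular_co_radiant :: "'a::real_normed_vector set \<Rightarrow> bool" where
  "regular_co_radiant K \<longleftrightarrow>
     (\<forall>\<epsilon>>0. co_radiant_reduction K \<epsilon> \<noteq> {} \<longrightarrow> admits_norm_base (co_radiant_reduction K \<epsilon>))"

text \<open>The radial profile is only meant to be used on the unit sphere. The infimum is taken
  in \<^typ>\<open>ereal\<close>, so it is \<open>\<infinity>\<close> for the empty set.\<close>

definition radial_profile :: "'a::real_normed_vector set \<Rightarrow> 'a \<Rightarrow> ereal" where
  "radial_profile K v = Inf {ereal c | c. c > 0 \<and> c *\<^sub>R v \<in> K}"

definition radial_dom :: "'a::real_normed_vector set \<Rightarrow> 'a set" where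
  "radial_dom K = {v \<in> sphere 0 1. radial_profile K v < \<infinity>}"

end

theory Submission imports Defs begin

text \<open>
  A norm-base at radius \<open>t\<close> says that every ray from the origin meeting \<open>K\<close> already has its
  point of norm \<open>t\<close> in \<open>K\<close>. Since a co-radiant set contains, along each ray, everything beyond
  any of its points, the infimum of the radii at which the ray lies in \<open>K\<close> decides this: it is at
  most \<open>t\<close> if the point at radius \<open>t\<close> belongs to \<open>K\<close>, and conversely the point at radius \<open>t\<close>
  belongs to \<open>K\<close> if the infimum is strictly below \<open>t\<close>
  (\<open>scaled_mem_of_radial_profile_less\<close>). So a common radius \<open>t\<close> for all rays exists
  if and only if the radial profile has a common finite bound on its domain.

  For regularity, an interior reduction removes from \<open>K\<close> whole open rays only. The rays that
  survive keep all of their points, so the norm-base radius of \<open>K\<close> works for every reduction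
  (\<open>norm_base_at_Int\<close>).
\<close>

text \<open>The point of radius \<open>t\<close> on the ray through \<open>x\<close> is the only possible witness, which makes
  the norm-base condition explicit.\<close>

lemma norm_base_at_iff:
  fixes K :: "'a::real_normed_vector set"
  assumes "0 \<notin> K"
  shows "norm_base_at K t \<longleftrightarrow> t > 0 \<and> (\<forall>x\<in>K. (t / norm x) *\<^sub>R x \<in> K)"
proof
  assume base: "norm_base_at K t"
  then have t: "t > 0"
    by (simp add: norm_base_at_def)
  have "(t / norm x) *\<^sub>R x \<in> K" if x: "x \<in> K" for x
  proof -
    obtain y c where y: "y \<in> K" "norm y = t" and c: "c > 0" "x = c *\<^sub>R y"
      using base x by (auto simp: norm_base_at_def)
    then have "(t / norm x) *\<^sub>R x = y"
      using t by simp
    then show ?thesis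
      using y by simp
  qed
  with t show "t > 0 \<and> (\<forall>x\<in>K. (t / norm x) *\<^sub>R x \<in> K)"
    by blast
next
  assume radius: "t > 0 \<and> (\<forall>x\<in>K. (t / norm x) *\<^sub>R x \<in> K)"
  have "\<exists>y \<in> K \<inter> sphere 0 t. \<exists>c>0. x = c *\<^sub>R y" if x: "x \<in> K" for x
  proof (intro bexI exI conjI)
    have "x \<noteq> 0"
      using x assms by auto
    then show "norm x / t > 0" "x = (norm x / t) *\<^sub>R ((t / norm x) *\<^sub>R x)"
      using radius by simp_all
    show "(t / norm x) *\<^sub>R x \<in> K \<inter> sphere 0 t"
      using radius x \<open>x \<noteq> 0\<close> by simp
  qed
  with radius show "norm_base_at K t"
    by (simp add: norm_base_at_def)
qed

lemma radial_profile_le: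
  assumes "c > 0" "c *\<^sub>R v \<in> K"
  shows "radial_profile K v \<le> ereal c"
  unfolding radial_profile_def using assms by (intro Inf_lower) blast

lemma radial_profile_lessE:
  assumes "radial_profile K v < b"
  obtains c where "c > 0" "c *\<^sub>R v \<in> K" "ereal c < b"
  using assms unfolding radial_profile_def Inf_less_iff by blast

text \<open>The inequality must be strict because the infimum need not be attained: the ray may enter
  \<open>K\<close> without its endpoint.\<close>

lemma scaled_mem_of_radial_profile_less:
  assumes "co_radiant K" "radial_profile K v < ereal t"
  shows "t *\<^sub>R v \<in> K"
proof -
  obtain c where c: "c > 0" "c *\<^sub>R v \<in> K" "c < t"
    using assms(2) by (auto elim: radial_profile_lessE)
  then have "(t / c) *\<^sub>R (c *\<^sub>R v) \<in> K"
    using assms(1) by (simp add: co_radiant_def del: scaleR_scaleR)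
  then show ?thesis
    using c by simp
qed

lemma normalized_mem_radial_dom:
  assumes "x \<in> K" "x \<noteq> 0"
  shows "(1 / norm x) *\<^sub>R x \<in> radial_dom K"
proof -
  have "radial_profile K ((1 / norm x) *\<^sub>R x) \<le> ereal (norm x)"
    using assms by (intro radial_profile_le) auto
  then have "radial_profile K ((1 / norm x) *\<^sub>R x) < \<infinity>"
    by (rule order.strict_trans1) simp
  then show ?thesis
    using assms by (simp add: radial_dom_def)
qed

lemma admits_norm_base_iff_radial_profile_bounded:
  fixes K :: "'a::real_normed_vector set"
  assumes K: "co_radiant K"
  shows "admits_norm_base K \<longleftrightarrow> (\<exists>M::real. \<forall>v \<in> radial_dom K. radial_profile K v \<le> ereal M)"
proof
  have "0 \<notin> K"
    using K by (simp add: co_radiant_def)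
  note base_iff = norm_base_at_iff[OF this]
  {
    assume "admits_norm_base K"
    then obtain t where t: "t > 0" and radius: "\<And>x. x \<in> K \<Longrightarrow> (t / norm x) *\<^sub>R x \<in> K"
      by (auto simp: admits_norm_base_def base_iff)
    have "radial_profile K v \<le> ereal t" if "v \<in> radial_dom K" for v
    proof (rule radial_profile_le[OF t])
      have v: "norm v = 1" "radial_profile K v < \<infinity>"
        using that by (auto simp: radial_dom_def)
      then obtain c where c: "c > 0" "c *\<^sub>R v \<in> K"
        by (blast elim: radial_profile_lessE)
      then show "t *\<^sub>R v \<in> K"
        using radius[OF c(2)] v by simp
    qed
    then show "\<exists>M::real. \<forall>v \<in> radial_dom K. radial_profile K v \<le> ereal M"
      by blast
  next
    assume "\<exists>M::real. \<forall>v \<in> radial_dom K. radial_profile K v \<le> ereal M"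
    then obtain M where M: "\<And>v. v \<in> radial_dom K \<Longrightarrow> radial_profile K v \<le> ereal M"
      by blast
    \<comment> \<open>A radius that is positive and strictly above the bound.\<close>
    define t where "t = \<bar>M\<bar> + 1"
    have "(t / norm x) *\<^sub>R x \<in> K" if x: "x \<in> K" for x
    proof -
      have "x \<noteq> 0"
        using x \<open>0 \<notin> K\<close> by auto
      then have "radial_profile K ((1 / norm x) *\<^sub>R x) \<le> ereal M"
        using x by (intro M normalized_mem_radial_dom)
      also have "ereal M < ereal t"
        by (simp add: t_def)
      finally have "t *\<^sub>R ((1 / norm x) *\<^sub>R x) \<in> K"
        by (rule scaled_mem_of_radial_profile_less[OF K])
      then show ?thesis
        by simp
    qed
    moreover have "t > 0"
      by (simp add: t_def)
    ultimately show "admits_norm_base K"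
      by (auto simp: admits_norm_base_def base_iff)
  }
qed

text \<open>A set closed under positive scaling is a union of open rays and possibly the origin, so
  intersecting with it keeps or discards a point of \<open>K\<close> together with its witness on the sphere.\<close>

lemma norm_base_at_Int:
  fixes K :: "'a::real_normed_vector set"
  assumes base: "norm_base_at K t"
    and scale: "\<And>x c. x \<in> C \<Longrightarrow> c > 0 \<Longrightarrow> c *\<^sub>R x \<in> C"
  shows "norm_base_at (K \<inter> C) t"
proof -
  have "\<exists>y \<in> (K \<inter> C) \<inter> sphere 0 t. \<exists>c>0. x = c *\<^sub>R y" if x: "x \<in> K \<inter> C" for x
  proof -
    obtain y c where y: "y \<in> K \<inter> sphere 0 t" and c: "c > 0" "x = c *\<^sub>R y"
      using base x by (auto simp: norm_base_at_def)
    have "inverse c *\<^sub>R x \<in> C"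
      using x c by (intro scale) auto
    then have "y \<in> C"
      using c by simp
    then show ?thesis
      using y c by blast
  qed
  then show ?thesis
    using base by (simp add: norm_base_at_def)
qed

lemma cone_of_scaleR:
  assumes "x \<in> cone_of A" "c \<ge> 0"
  shows "c *\<^sub>R x \<in> cone_of A"
proof -
  obtain d a where "d \<ge> 0" "a \<in> A" "x = d *\<^sub>R a"
    using assms(1) by (auto simp: cone_of_def)
  then have "c *\<^sub>R x = (c * d) *\<^sub>R a" "c * d \<ge> 0"
    using assms(2) by simp_all
  then show ?thesis
    using \<open>a \<in> A\<close> unfolding cone_of_def by blast
qed

lemma cone_of_scaleR_iff:
  assumes "c > 0"
  shows "c *\<^sub>R x \<in> cone_of A \<longleftrightarrow> x \<in> cone_of A"
  using cone_of_scaleR[of x A c] cone_of_scaleR[of "c *\<^sub>R x" A "inverse c"] assms by auto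

lemma cone_reduction_cone_of_scaleR:
  assumes "x \<in> cone_reduction (cone_of A) \<epsilon>" "c > 0"
  shows "c *\<^sub>R x \<in> cone_reduction (cone_of A) \<epsilon>"
  using assms by (simp add: cone_reduction_def cone_of_scaleR_iff)

lemma admits_norm_base_imp_regular:
  assumes "admits_norm_base K"
  shows "regular_co_radiant K"
proof -
  obtain t where "norm_base_at K t"
    using assms by (auto simp: admits_norm_base_def)
  then have "norm_base_at (co_radiant_reduction K \<epsilon>) t" for \<epsilon>
    unfolding co_radiant_reduction_def
    by (rule norm_base_at_Int) (rule cone_reduction_cone_of_scaleR)
  then show ?thesis
    by (auto simp: regular_co_radiant_def admits_norm_base_def)
qed

theorem lemma5p8:
  fixes K :: "'a::real_normed_vector set"
  assumes "co_radiant K"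
  shows "(admits_norm_base K \<longleftrightarrow>
            (\<exists>M::real. \<forall>v \<in> radial_dom K. radial_profile K v \<le> ereal M)) \<and>
         (admits_norm_base K \<longrightarrow> regular_co_radiant K)"
  using admits_norm_base_iff_radial_profile_bounded[OF assms] admits_norm_base_imp_regular
  by blast

end
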